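(* Let $k\ge 1$ be an integer. If $\mathcal{F}$ is an intersecting family of $2k-1$ sets with $\tau(\mathcal{F})=k$, then $\mathcal{F}$ is triangular.
   Context: A family $\mathcal{F}$ of sets is intersecting if $A\cap B\ne\emptyset$ for all $A,B\in\mathcal{F}$. A transversal of $\mathcal{F}$ is a set $X$ with $X\cap F\ne\emptyset$ for every $F\in\mathcal{F}$, and $\tau(\mathcal{F})$ is the minimum size of a transversal of $\mathcal{F}$. A family $\mathcal{F}$ is triangular if $A\cap B\cap C=\emptyset$ for every three distinct members $A,B,C\in\mathcal{F}$ (so every family of at most two sets is triangular). *)

theory Defs
  imports Main
begin

definition intersecting :: "'a set set \<Rightarrow> bool" where
  "intersecting F \<longleftrightarrow> (\<forall>A\<in>F. \<forall>B\<in>F. A \<inter> B \<noteq> {})"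

definition transversal :: "'a set set \<Rightarrow> 'a set \<Rightarrow> bool" where
  "transversal F X \<longleftrightarrow> (\<forall>A\<in>F. X \<inter> A \<noteq> {})"

text \<open>
  The transversal number as a natural number. It is meaningful for families that have a
  finite transversal; every finite family of nonempty sets has one.
\<close>

definition transversal_number :: "'a set set \<Rightarrow> nat" (\<open>\<tau>\<close>) where
  "\<tau> F = (LEAST n. \<exists>X. finite X \<and> card X = n \<and> transversal F X)"

definition triangular :: "'a set set \<Rightarrow> bool" where
  "triangular F \<longleftrightarrow>
    (\<forall>A\<in>F. \<forall>B\<in>F. \<forall>C\<in>F. A \<noteq> B \<and> A \<noteq> C \<and> B \<noteq> C \<longrightarrow> A \<inter> B \<inter> C = {})"

end

theory Submission imports Defs begin

text \<open>
  Pairing up the members of an intersecting family and picking a common point of each pair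
  gives a transversal of half the size. If three members shared a point, that point together
  with a pairing of the other \<open>2k - 4\<close> members would give a transversal of size at most \<open>k - 1\<close>.
\<close>

lemma transversal_number_le:
  assumes "finite X" "transversal F X"
  shows "\<tau> F \<le> card X"
  unfolding transversal_number_def by (rule Least_le) (use assms in blast)

lemma intersecting_transversal_half:
  assumes "finite G" "intersecting G" "card G = 2 * n"
  shows "\<exists>X. finite X \<and> card X \<le> n \<and> transversal G X"
  using assms
proof (induction n arbitrary: G)
  case 0
  then show ?case
    by (intro exI[of _ "{}"]) (simp add: transversal_def)
next
  case (Suc n)
  obtain A G' where G': "G = insert A G'" "A \<notin> G'" "card G' = Suc (2 * n)"
    using card_Suc_eq[of G "Suc (2 * n)"] Suc.prems(3) by auto
  obtain B H where H: "G' = insert B H" "B \<notin> H" "card H = 2 * n"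
    using card_Suc_eq[of G' "2 * n"] G'(3) by auto
  obtain x where x: "x \<in> A" "x \<in> B"
    using Suc.prems(2) G'(1) H(1) unfolding intersecting_def by blast
  have "finite H" "intersecting H"
    using Suc.prems(1,2) G'(1) H(1) by (auto simp: intersecting_def)
  then obtain X where X: "finite X" "card X \<le> n" "transversal H X"
    using Suc.IH H(3) by blast
  \<comment> \<open>Only an upper bound survives the induction: \<open>x\<close> may already lie in
    \<open>X\<close>, since different pairs can yield the same point.\<close>
  have "card (insert x X) \<le> Suc n"
    using X by (simp add: card_insert_if)
  moreover have "transversal G (insert x X)"
    using X(3) x G'(1) H(1) by (auto simp: transversal_def)
  ultimately show ?case
    using X(1) by blast
qed

theorem theorem20:
  fixes F :: "'a set set" and k :: nat
  assumes "k \<ge> 1"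
    and "intersecting F"
    and "card F = 2 * k - 1"
    and "\<tau> F = k"
  shows "triangular F"
proof (rule ccontr)
  assume "\<not> triangular F"
  then obtain A B C x where T: "{A, B, C} \<subseteq> F" "A \<noteq> B" "A \<noteq> C" "B \<noteq> C"
    and x: "x \<in> A" "x \<in> B" "x \<in> C"
    unfolding triangular_def by blast
  \<comment> \<open>\<open>card\<close> is 0 on infinite sets, so finiteness follows from
    \<open>2 * k - 1 > 0\<close>.\<close>
  have "finite F"
    using assms(1,3) by (intro card_ge_0_finite) simp
  have card_T: "card {A, B, C} = 3"
    using T by simp
  then have "3 \<le> card F"
    using card_mono[OF \<open>finite F\<close> T(1)] by simp
  \<comment> \<open>Subtraction on \<open>nat\<close> truncates: this bound ensures that
    \<open>Suc (k - 2)\<close> is \<open>k - 1\<close>, hence below \<open>k\<close>, at the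
    end.\<close>
  then have "k \<ge> 2"
    using assms(3) by simp
  \<comment> \<open>Three taken from the odd number \<open>2 * k - 1\<close> leaves an even number,
    so the remaining members pair up exactly.\<close>
  have "card (F - {A, B, C}) = 2 * (k - 2)"
    using card_Diff_subset[OF _ T(1)] card_T assms(3) by simp
  moreover have "intersecting (F - {A, B, C})"
    using assms(2) by (simp add: intersecting_def)
  ultimately obtain X where X: "finite X" "card X \<le> k - 2" "transversal (F - {A, B, C}) X"
    using intersecting_transversal_half \<open>finite F\<close> by blast
  have "transversal F (insert x X)"
    using X(3) x unfolding transversal_def by blast
  then have "\<tau> F \<le> card (insert x X)"
    using X(1) by (intro transversal_number_le) simp_all
  also have "\<dots> \<le> Suc (k - 2)"
    using X by (simp add: card_insert_if)
  finally show False
    using assms(4) \<open>k \<ge> 2\<close> by simp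
qed

end
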